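(* Let $F$ be the subgroup of $GL_2(\mathbb{Z})$ generated by $\begin{pmatrix}1&0\\0&-1\end{pmatrix}$ and $\begin{pmatrix}0&1\\1&0\end{pmatrix}$ (a dihedral group of order 8, the isometry group of the square $[-1,1]\times[-1,1]$). Let $G=\mathbb{Z}^2\rtimes F$ (with the natural linear action) and $H=\mathbb{Z}^2$, viewed as an index 8 subgroup of $G$. Then the full box spaces $\square H$ and $\square G$ are not coarsely equivalent.
   Context: A map $f:X\to Y$ of metric spaces is a coarse embedding if for all sequences $(x_n),(y_n)$ in $X$: $d_X(x_n,y_n)\to+\infty \iff d_Y(f(x_n),f(y_n))\to +\infty$. It is a coarse equivalence if moreover there is $R\ge 0$ such that $Y$ is the $R$-neighbourhood of $f(X)$. Full box space: for a finitely generated residually finite group $G$ with a fixed finite generating set $S$, $\square G=\coprod_{N\triangleleft G,\,[G:N]<\infty}G/N$ (one component for each finite index normal subgroup). Each $G/N$ carries the word metric from the image of $S$, and $\square G$ is endowed with a metric inducing these metrics on components and such that the distance between two different components is at least the maximum of their diameters. It is well-defined up to coarse equivalence. *)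

theory Defs
  imports "HOL-Analysis.Analysis" "HOL-Algebra.Generated_Groups"
begin

definition coarse_embedding :: "'a metric \<Rightarrow> 'b metric \<Rightarrow> ('a \<Rightarrow> 'b) \<Rightarrow> bool" where
  "coarse_embedding X Y f \<longleftrightarrow>
     f ` mspace X \<subseteq> mspace Y \<and>
     (\<forall>(x :: nat \<Rightarrow> 'a) (y :: nat \<Rightarrow> 'a). range x \<subseteq> mspace X \<longrightarrow> range y \<subseteq> mspace X \<longrightarrow>
        (filterlim (\<lambda>n. mdist X (x n) (y n)) at_top sequentially \<longleftrightarrow>
         filterlim (\<lambda>n. mdist Y (f (x n)) (f (y n))) at_top sequentially))"

definition coarse_equivalence :: "'a metric \<Rightarrow> 'b metric \<Rightarrow> ('a \<Rightarrow> 'b) \<Rightarrow> bool" where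
  "coarse_equivalence X Y f \<longleftrightarrow>
     coarse_embedding X Y f \<and>
     (\<exists>R\<ge>0. mspace Y = {y \<in> mspace Y. \<exists>x\<in>mspace X. mdist Y (f x) y \<le> R})"

definition coarsely_equivalent :: "'a metric \<Rightarrow> 'b metric \<Rightarrow> bool" where
  "coarsely_equivalent X Y \<longleftrightarrow> (\<exists>f. coarse_equivalence X Y f)"

definition finite_generating_set :: "('a, 'b) monoid_scheme \<Rightarrow> 'a set \<Rightarrow> bool" where
  "finite_generating_set G S \<longleftrightarrow> finite S \<and> S \<subseteq> carrier G \<and> generate G S = carrier G"

definition word_value :: "('a, 'b) monoid_scheme \<Rightarrow> 'a list \<Rightarrow> 'a" where
  "word_value G ws = foldr (\<otimes>\<^bsub>G\<^esub>) ws \<one>\<^bsub>G\<^esub>"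

definition word_length :: "('a, 'b) monoid_scheme \<Rightarrow> 'a set \<Rightarrow> 'a \<Rightarrow> nat" where
  "word_length G S g =
     (LEAST n. \<exists>ws. length ws = n \<and> set ws \<subseteq> S \<union> m_inv G ` S \<and> word_value G ws = g)"

definition word_dist :: "('a, 'b) monoid_scheme \<Rightarrow> 'a set \<Rightarrow> 'a \<Rightarrow> 'a \<Rightarrow> real" where
  "word_dist G S x y = real (word_length G S (inv\<^bsub>G\<^esub> x \<otimes>\<^bsub>G\<^esub> y))"

definition finite_index_normals :: "('a, 'b) monoid_scheme \<Rightarrow> 'a set set" where
  "finite_index_normals G = {N. N \<lhd> G \<and> finite (rcosets\<^bsub>G\<^esub> N)}"

text \<open>
  A point of the disjoint union of the quotients is a pair \<open>(N, c)\<close> with \<open>c\<close> a coset of \<open>N\<close>.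
\<close>

definition box_component :: "('a, 'b) monoid_scheme \<Rightarrow> 'a set \<Rightarrow> ('a set \<times> 'a set) set" where
  "box_component G N = {N} \<times> carrier (G Mod N)"

definition quotient_dist :: "('a, 'b) monoid_scheme \<Rightarrow> 'a set \<Rightarrow> 'a set \<Rightarrow> 'a set \<Rightarrow> 'a set \<Rightarrow> real" where
  "quotient_dist G S N = word_dist (G Mod N) ((\<lambda>s. N #>\<^bsub>G\<^esub> s) ` S)"

definition mdiam :: "'a metric \<Rightarrow> 'a set \<Rightarrow> real" where
  "mdiam m A = (SUP (p, q) \<in> A \<times> A. mdist m p q)"

text \<open>
  The metric on a full box space is not unique, so the notion is a predicate: \<open>m\<close> is any metric
  that the definition of the full box space of \<open>G\<close> with respect to \<open>S\<close> allows.
\<close>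

definition full_box_space ::
    "('a, 'b) monoid_scheme \<Rightarrow> 'a set \<Rightarrow> ('a set \<times> 'a set) metric \<Rightarrow> bool" where
  "full_box_space G S m \<longleftrightarrow>
     mspace m = (\<Union>N\<in>finite_index_normals G. box_component G N) \<and>
     (\<forall>N\<in>finite_index_normals G. \<forall>x\<in>carrier (G Mod N). \<forall>y\<in>carrier (G Mod N).
        mdist m (N, x) (N, y) = quotient_dist G S N x y) \<and>
     (\<forall>N\<in>finite_index_normals G. \<forall>N'\<in>finite_index_normals G. N \<noteq> N' \<longrightarrow>
        (\<forall>p\<in>box_component G N. \<forall>q\<in>box_component G N'.
           max (mdiam m (box_component G N)) (mdiam m (box_component G N')) \<le> mdist m p q))"

definition semidirect_product ::
    "('a, 'c) monoid_scheme \<Rightarrow> ('b, 'd) monoid_scheme \<Rightarrow> ('b \<Rightarrow> 'a \<Rightarrow> 'a) \<Rightarrow> ('a \<times> 'b) monoid" where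
  "semidirect_product N K \<phi> =
     \<lparr>carrier = carrier N \<times> carrier K,
      monoid.mult = (\<lambda>(a, k) (b, l). (a \<otimes>\<^bsub>N\<^esub> \<phi> k b, k \<otimes>\<^bsub>K\<^esub> l)),
      one = (\<one>\<^bsub>N\<^esub>, \<one>\<^bsub>K\<^esub>)\<rparr>"

definition Z2_group :: "(int ^ 2) monoid" where
  "Z2_group = \<lparr>carrier = UNIV, monoid.mult = (+), one = 0\<rparr>"

definition GL2Z :: "(int ^ 2 ^ 2) monoid" where
  "GL2Z = units_of \<lparr>carrier = UNIV, monoid.mult = (**), one = mat 1\<rparr>"

definition refl_mat :: "int ^ 2 ^ 2" where
  "refl_mat = vector [vector [1, 0], vector [0, -1]]"

definition swap_mat :: "int ^ 2 ^ 2" where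
  "swap_mat = vector [vector [0, 1], vector [1, 0]]"

definition F_group :: "(int ^ 2 ^ 2) monoid" where
  "F_group = GL2Z\<lparr>carrier := generate GL2Z {refl_mat, swap_mat}\<rparr>"

definition G_group :: "((int ^ 2) \<times> (int ^ 2 ^ 2)) monoid" where
  "G_group = semidirect_product Z2_group F_group (*v)"

lemma group_semidirect_product:
  assumes "group N" "group K"
    and hom: "\<And>k. k \<in> carrier K \<Longrightarrow> \<phi> k \<in> hom N N"
    and one: "\<And>a. a \<in> carrier N \<Longrightarrow> \<phi> \<one>\<^bsub>K\<^esub> a = a"
    and mult: "\<And>k l a. k \<in> carrier K \<Longrightarrow> l \<in> carrier K \<Longrightarrow> a \<in> carrier N \<Longrightarrow>
                 \<phi> (k \<otimes>\<^bsub>K\<^esub> l) a = \<phi> k (\<phi> l a)"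
  shows "group (semidirect_product N K \<phi>)"
proof -
  interpret N: group N by fact
  interpret K: group K by fact
  have cl: "\<phi> k a \<in> carrier N" if "k \<in> carrier K" "a \<in> carrier N" for k a
    using hom[OF that(1)] that(2) by (auto simp: hom_def)
  have ml: "\<phi> k (a \<otimes>\<^bsub>N\<^esub> b) = \<phi> k a \<otimes>\<^bsub>N\<^esub> \<phi> k b"
    if "k \<in> carrier K" "a \<in> carrier N" "b \<in> carrier N" for k a b
    using hom[OF that(1)] that by (auto simp: hom_def)
  show ?thesis
  proof (rule groupI)
    fix x assume "x \<in> carrier (semidirect_product N K \<phi>)"
    then obtain a k where x: "x = (a, k)" and a: "a \<in> carrier N" and k: "k \<in> carrier K"
      by (auto simp: semidirect_product_def)
    have ik: "inv\<^bsub>K\<^esub> k \<in> carrier K" using k by simp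
    have "\<phi> (inv\<^bsub>K\<^esub> k) (inv\<^bsub>N\<^esub> a) \<otimes>\<^bsub>N\<^esub> \<phi> (inv\<^bsub>K\<^esub> k) a = \<phi> (inv\<^bsub>K\<^esub> k) \<one>\<^bsub>N\<^esub>"
      using ml[OF ik, of "inv\<^bsub>N\<^esub> a" a] a by simp
    also have "\<dots> = \<one>\<^bsub>N\<^esub>"
      using ml[OF ik, of "\<one>\<^bsub>N\<^esub>" "\<one>\<^bsub>N\<^esub>"] cl[OF ik, of "\<one>\<^bsub>N\<^esub>"] by simp
    finally show "\<exists>y\<in>carrier (semidirect_product N K \<phi>).
        y \<otimes>\<^bsub>semidirect_product N K \<phi>\<^esub> x = \<one>\<^bsub>semidirect_product N K \<phi>\<^esub>"
      using a k cl
      by (intro bexI[of _ "(\<phi> (inv\<^bsub>K\<^esub> k) (inv\<^bsub>N\<^esub> a), inv\<^bsub>K\<^esub> k)"])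
         (auto simp: semidirect_product_def x)
  qed (auto simp: semidirect_product_def cl ml one mult N.m_assoc K.m_assoc)
qed

lemma group_Z2_group: "group Z2_group"
proof (rule groupI)
  fix x assume "x \<in> carrier Z2_group"
  show "\<exists>y\<in>carrier Z2_group. y \<otimes>\<^bsub>Z2_group\<^esub> x = \<one>\<^bsub>Z2_group\<^esub>"
    by (intro bexI[of _ "- x"]) (auto simp: Z2_group_def)
qed (auto simp: Z2_group_def)

lemma monoid_int_matrices:
  "Group.monoid \<lparr>carrier = UNIV, monoid.mult = (**), one = mat 1 :: int ^ 2 ^ 2\<rparr>"
  by (rule monoidI) (auto simp: matrix_mul_assoc)

lemma group_GL2Z: "group GL2Z"
  unfolding GL2Z_def by (rule monoid.units_group[OF monoid_int_matrices])

lemma carrier_GL2Z: "carrier GL2Z = {A. invertible A}"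
  by (auto simp: GL2Z_def units_of_def Units_def invertible_def)

lemma mult_GL2Z [simp]: "A \<otimes>\<^bsub>GL2Z\<^esub> B = A ** B"
  by (simp add: GL2Z_def units_of_def)

lemma one_GL2Z [simp]: "\<one>\<^bsub>GL2Z\<^esub> = mat 1"
  by (simp add: GL2Z_def units_of_def)

lemma mat2_eq_iff: "(A :: int ^ 2 ^ 2) = B \<longleftrightarrow>
    A$1$1 = B$1$1 \<and> A$1$2 = B$1$2 \<and> A$2$1 = B$2$1 \<and> A$2$2 = B$2$2"
  by (auto simp: vec_eq_iff forall_2)

lemma refl_mat_sq: "refl_mat ** refl_mat = mat 1"
  and swap_mat_sq: "swap_mat ** swap_mat = mat 1"
  by (auto simp: mat2_eq_iff refl_mat_def swap_mat_def matrix_matrix_mult_def sum_2 mat_def)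

lemma gens_in_GL2Z: "{refl_mat, swap_mat} \<subseteq> carrier GL2Z"
  using refl_mat_sq swap_mat_sq by (auto simp: carrier_GL2Z invertible_def)

lemma subgroup_F: "subgroup (generate GL2Z {refl_mat, swap_mat}) GL2Z"
  by (rule group.generate_is_subgroup[OF group_GL2Z gens_in_GL2Z])

lemma group_F_group: "group F_group"
  unfolding F_group_def by (rule group.subgroup_imp_group[OF group_GL2Z subgroup_F])

lemma group_G_group: "group G_group"
  unfolding G_group_def
proof (rule group_semidirect_product[OF group_Z2_group group_F_group])
  show "(*v) k \<in> hom Z2_group Z2_group" for k
    by (auto simp: hom_def Z2_group_def matrix_vector_right_distrib)
qed (auto simp: F_group_def matrix_vector_mul_assoc)

lemma carrier_F_group:
  "carrier F_group =
     (\<lambda>(a, b). vector [vector [a, 0], vector [0, b]]) ` ({1, -1} \<times> {1, -1}) \<union>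
     (\<lambda>(a, b). vector [vector [0, a], vector [b, 0]]) ` ({1, -1} \<times> {1, -1})"
  (is "_ = ?D")
proof
  have D_iff: "A \<in> ?D \<longleftrightarrow>
      \<bar>A$1$1\<bar> = 1 \<and> A$1$2 = 0 \<and> A$2$1 = 0 \<and> \<bar>A$2$2\<bar> = 1 \<or>
      A$1$1 = 0 \<and> \<bar>A$1$2\<bar> = 1 \<and> \<bar>A$2$1\<bar> = 1 \<and> A$2$2 = 0" (is "_ \<longleftrightarrow> ?P \<or> ?Q") for A
  proof
    show "A \<in> ?D \<Longrightarrow> ?P \<or> ?Q" by auto
  next
    assume "?P \<or> ?Q"
    then show "A \<in> ?D"
    proof
      assume ?P
      then show ?thesis
        by (intro UnI1 image_eqI[of _ _ "(A$1$1, A$2$2)"]) (simp_all add: mat2_eq_iff, linarith)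
    next
      assume ?Q
      then show ?thesis
        by (intro UnI2 image_eqI[of _ _ "(A$1$2, A$2$1)"]) (simp_all add: mat2_eq_iff, linarith)
    qed
  qed
  have inv_id: "inv\<^bsub>GL2Z\<^esub> h = h" if "h \<in> {refl_mat, swap_mat}" for h
    using that refl_mat_sq swap_mat_sq gens_in_GL2Z
    by (auto intro!: group.inv_equality[OF group_GL2Z])
  have gens: "{refl_mat, swap_mat} \<subseteq> ?D"
    by (auto simp: refl_mat_def swap_mat_def)
  have "A \<in> ?D" if "A \<in> generate GL2Z {refl_mat, swap_mat}" for A
    using that
  proof induction
    case one
    then show ?case by (auto simp: mat2_eq_iff mat_def)
  next
    case (incl h)
    then show ?case using gens by blast
  next
    case (inv h)
    then show ?case using gens inv_id by auto
  next
    case (eng A B)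
    then show ?case
      unfolding D_iff mult_GL2Z
      by (elim disjE; simp add: matrix_matrix_mult_def sum_2 abs_mult)
  qed
  moreover have "carrier F_group = generate GL2Z {refl_mat, swap_mat}"
    by (simp add: F_group_def)
  ultimately show "carrier F_group \<subseteq> ?D"
    by (metis subsetI)
next
  let ?F = "generate GL2Z {refl_mat, swap_mat}"
  have r: "refl_mat \<in> ?F" and s: "swap_mat \<in> ?F" by (auto intro: generate.incl)
  have m: "A ** B \<in> ?F" if "A \<in> ?F" "B \<in> ?F" for A B
    using generate.eng[OF that] by simp
  note m3 = m[OF m] and sr = m[OF s r] and rs = m[OF r s]
  have "mat 1 \<in> ?F" using generate.one[of GL2Z] by simp
  note all = this r s sr rs m[OF sr s] m[OF rs r] m[OF sr sr]
  show "?D \<subseteq> carrier F_group"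
  proof
    fix A assume "A \<in> ?D"
    then have "A \<in> {mat 1, refl_mat, swap_mat, swap_mat ** refl_mat, refl_mat ** swap_mat,
      swap_mat ** refl_mat ** swap_mat, refl_mat ** swap_mat ** refl_mat,
      (swap_mat ** refl_mat) ** (swap_mat ** refl_mat)}"
      by (auto simp: mat2_eq_iff refl_mat_def swap_mat_def matrix_matrix_mult_def sum_2 mat_def)
    then show "A \<in> carrier F_group"
      using all by (auto simp: F_group_def)
  qed
qed

lemma card_F_group: "card (carrier F_group) = 8"
proof -
  have "inj_on (\<lambda>(a, b). vector [vector [a, 0], vector [0, b]] :: int ^ 2 ^ 2) ({1, -1} \<times> {1, -1})"
    "inj_on (\<lambda>(a, b). vector [vector [0, a], vector [b, 0]] :: int ^ 2 ^ 2) ({1, -1} \<times> {1, -1})"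
    by (auto simp: inj_on_def mat2_eq_iff)
  then show ?thesis
    unfolding carrier_F_group
    by (subst card_Un_disjoint) (auto simp: card_image mat2_eq_iff simp del: insert_Times_insert)
qed

lemma Z2_group_embeds:
  "(\<lambda>v. (v, mat 1)) \<in> hom Z2_group G_group"
  "inj_on (\<lambda>v. (v, mat 1 :: int ^ 2 ^ 2)) (carrier Z2_group)"
  "card (rcosets\<^bsub>G_group\<^esub> ((\<lambda>v. (v, mat 1)) ` carrier Z2_group)) = 8"
proof -
  have one: "mat 1 \<in> carrier F_group"
    using group.is_monoid[OF group_F_group] monoid.one_closed[of F_group] by (simp add: F_group_def)
  show "(\<lambda>v. (v, mat 1)) \<in> hom Z2_group G_group"
    using one by (auto simp: hom_def G_group_def semidirect_product_def Z2_group_def F_group_def)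
  show "inj_on (\<lambda>v. (v, mat 1 :: int ^ 2 ^ 2)) (carrier Z2_group)"
    by (auto simp: inj_on_def)
  have coset: "((\<lambda>v. (v, mat 1)) ` carrier Z2_group) #>\<^bsub>G_group\<^esub> (w, A) = UNIV \<times> {A}" for w A
  proof -
    have "\<exists>x. v = x + w" for v :: "int ^ 2" by (rule exI[of _ "v - w"]) simp
    then show ?thesis
      by (auto simp: r_coset_def G_group_def semidirect_product_def Z2_group_def F_group_def)
  qed
  have "rcosets\<^bsub>G_group\<^esub> ((\<lambda>v. (v, mat 1)) ` carrier Z2_group) = (\<lambda>A. UNIV \<times> {A}) ` carrier F_group"
    unfolding RCOSETS_def
    by (auto simp: coset G_group_def semidirect_product_def Z2_group_def)
       (auto simp: coset[unfolded G_group_def semidirect_product_def Z2_group_def, simplified])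
  moreover have "inj_on (\<lambda>A. UNIV \<times> {A} :: ((int ^ 2) \<times> (int ^ 2 ^ 2)) set) (carrier F_group)"
    by (auto simp: inj_on_def)
  ultimately show "card (rcosets\<^bsub>G_group\<^esub> ((\<lambda>v. (v, mat 1)) ` carrier Z2_group)) = 8"
    by (simp add: card_image card_F_group)
qed

context group
begin

lemma word_value_closed: "set ws \<subseteq> carrier G \<Longrightarrow> word_value G ws \<in> carrier G"
  by (induction ws) (auto simp: word_value_def)

lemma word_value_append:
  "set us \<subseteq> carrier G \<Longrightarrow> set vs \<subseteq> carrier G \<Longrightarrow>
   word_value G (us @ vs) = word_value G us \<otimes> word_value G vs"
  using word_value_closed by (induction us) (auto simp: word_value_def m_assoc)

lemma word_value_inv:
  "set ws \<subseteq> carrier G \<Longrightarrow> word_value G (rev (map (m_inv G) ws)) = inv (word_value G ws)"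
proof (induction ws)
  case Nil
  then show ?case by (simp add: word_value_def)
next
  case (Cons w ws)
  have "word_value G (rev (map (m_inv G) ws) @ [inv w]) = inv (word_value G ws) \<otimes> inv w"
    using Cons by (subst word_value_append) (auto simp: word_value_def)
  then show ?case
    using Cons.prems word_value_closed[of ws] by (simp add: word_value_def inv_mult_group)
qed

lemma word_exists:
  assumes "S \<subseteq> carrier G" "g \<in> generate G S"
  shows "\<exists>ws. set ws \<subseteq> S \<union> m_inv G ` S \<and> word_value G ws = g"
  using assms(2)
proof induction
  case one
  show ?case by (rule exI[of _ "[]"]) (simp add: word_value_def)
next
  case (incl h)
  then show ?case using assms(1) by (intro exI[of _ "[h]"]) (auto simp: word_value_def)
next
  case (inv h)
  then show ?case using assms(1) by (intro exI[of _ "[inv h]"]) (auto simp: word_value_def)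
next
  case (eng g h)
  then obtain us vs where "set us \<subseteq> S \<union> m_inv G ` S" "word_value G us = g"
    "set vs \<subseteq> S \<union> m_inv G ` S" "word_value G vs = h" by blast
  moreover have "S \<union> m_inv G ` S \<subseteq> carrier G" using assms(1) by auto
  ultimately show ?case
    by (intro exI[of _ "us @ vs"]) (auto simp: word_value_append subset_trans)
qed

lemma word_length_le:
  "set ws \<subseteq> S \<union> m_inv G ` S \<Longrightarrow> word_length G S (word_value G ws) \<le> length ws"
  unfolding word_length_def by (rule Least_le) auto

lemma word_length_word:
  assumes "finite_generating_set G S" "g \<in> carrier G"
  obtains ws where "length ws = word_length G S g" "set ws \<subseteq> S \<union> m_inv G ` S"
    "set ws \<subseteq> carrier G" "word_value G ws = g"
proof -
  have "\<exists>n ws. length ws = n \<and> set ws \<subseteq> S \<union> m_inv G ` S \<and> word_value G ws = g"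
    using word_exists[of S g] assms by (auto simp: finite_generating_set_def)
  from LeastI_ex[OF this] obtain ws where
    "length ws = word_length G S g" "set ws \<subseteq> S \<union> m_inv G ` S" "word_value G ws = g"
    by (auto simp: word_length_def)
  moreover have "S \<union> m_inv G ` S \<subseteq> carrier G"
    using assms(1) by (auto simp: finite_generating_set_def)
  ultimately show ?thesis using that by blast
qed

lemma word_dist_zero:
  assumes "finite_generating_set G S" "x \<in> carrier G" "y \<in> carrier G"
  shows "word_dist G S x y = 0 \<longleftrightarrow> x = y"
proof
  assume "word_dist G S x y = 0"
  moreover obtain ws where "length ws = word_length G S (inv x \<otimes> y)"
    "word_value G ws = inv x \<otimes> y"
    using word_length_word[OF assms(1), of "inv x \<otimes> y"] assms by (metis inv_closed m_closed)
  ultimately have "inv x \<otimes> y = \<one>" by (simp add: word_dist_def word_value_def)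
  then show "x = y" using assms by (metis inv_closed inv_inv inv_equality)
next
  assume "x = y"
  then show "word_dist G S x y = 0"
    using word_length_le[of "[]" S] assms by (simp add: word_dist_def word_value_def)
qed

lemma word_length_inv_le:
  assumes "finite_generating_set G S" "g \<in> carrier G"
  shows "word_length G S (inv g) \<le> word_length G S g"
proof -
  obtain ws where ws: "length ws = word_length G S g" "set ws \<subseteq> S \<union> m_inv G ` S"
    "set ws \<subseteq> carrier G" "word_value G ws = g"
    using word_length_word assms by metis
  have "S \<subseteq> carrier G" using assms(1) by (simp add: finite_generating_set_def)
  then have "set (rev (map (m_inv G) ws)) \<subseteq> S \<union> m_inv G ` S"
    using ws(2) by (fastforce simp: subset_iff)
  from word_length_le[OF this] show ?thesis
    using ws word_value_inv[of ws] by simp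
qed

lemma word_dist_commute:
  assumes "finite_generating_set G S" "x \<in> carrier G" "y \<in> carrier G"
  shows "word_dist G S x y = word_dist G S y x"
proof -
  have "inv (inv x \<otimes> y) = inv y \<otimes> x" "inv (inv y \<otimes> x) = inv x \<otimes> y"
    using assms by (auto simp: inv_mult_group)
  then show ?thesis
    using word_length_inv_le[OF assms(1), of "inv x \<otimes> y"]
      word_length_inv_le[OF assms(1), of "inv y \<otimes> x"] assms by (simp add: word_dist_def)
qed

lemma word_dist_triangle:
  assumes "finite_generating_set G S" "x \<in> carrier G" "y \<in> carrier G" "z \<in> carrier G"
  shows "word_dist G S x z \<le> word_dist G S x y + word_dist G S y z"
proof -
  obtain us where us: "length us = word_length G S (inv x \<otimes> y)" "set us \<subseteq> S \<union> m_inv G ` S"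
    "set us \<subseteq> carrier G" "word_value G us = inv x \<otimes> y"
    using word_length_word[OF assms(1), of "inv x \<otimes> y"] assms by (metis inv_closed m_closed)
  obtain vs where vs: "length vs = word_length G S (inv y \<otimes> z)" "set vs \<subseteq> S \<union> m_inv G ` S"
    "set vs \<subseteq> carrier G" "word_value G vs = inv y \<otimes> z"
    using word_length_word[OF assms(1), of "inv y \<otimes> z"] assms by (metis inv_closed m_closed)
  have "y \<otimes> (inv y \<otimes> z) = z" using assms by (simp flip: m_assoc)
  then have "(inv x \<otimes> y) \<otimes> (inv y \<otimes> z) = inv x \<otimes> z" using assms by (simp add: m_assoc)
  then show ?thesis
    using word_length_le[of "us @ vs" S] us vs by (simp add: word_dist_def word_value_append)
qed

lemma finite_generating_set_quotient:
  assumes "finite_generating_set G S" "N \<lhd> G"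
  shows "finite_generating_set (G Mod N) ((\<lambda>s. N #> s) ` S)"
proof -
  interpret N: normal N G by fact
  interpret group_hom G "G Mod N" "\<lambda>s. N #> s"
    by (simp add: group_hom_def group_hom_axioms_def group_axioms N.factorgroup_is_group
        N.r_coset_hom_Mod)
  show ?thesis
    using assms(1) generate_img[of S]
    by (auto simp: finite_generating_set_def carrier_FactGroup)
qed

lemma full_box_space_exists:
  assumes gen: "finite_generating_set G S"
  shows "\<exists>m. full_box_space G S m"
proof -
  define Ns where "Ns = finite_index_normals G"
  define C where "C N = carrier (G Mod N)" for N
  define q where "q = quotient_dist G S"
  define D where "D N = Max ((\<lambda>(x, y). q N x y) ` (C N \<times> C N))" for N
  define M where "M = (\<Union>N\<in>Ns. box_component G N)"
  define d where "d a b = (if a \<in> M \<and> b \<in> M then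
    (if fst a = fst b then q (fst a) (snd a) (snd b) else D (fst a) + D (fst b)) else 0)" for a b
  have M_iff: "(N, x) \<in> M \<longleftrightarrow> N \<in> Ns \<and> x \<in> C N" for N x
    by (auto simp: M_def box_component_def C_def)
  have grp: "group (G Mod N)" if "N \<in> Ns" for N
    using that normal.factorgroup_is_group by (auto simp: Ns_def finite_index_normals_def)
  have fgs: "finite_generating_set (G Mod N) ((\<lambda>s. N #> s) ` S)" if "N \<in> Ns" for N
    using that finite_generating_set_quotient[OF gen] by (auto simp: Ns_def finite_index_normals_def)
  have q0: "q N x y = 0 \<longleftrightarrow> x = y" if "N \<in> Ns" "x \<in> C N" "y \<in> C N" for N x y
    using that group.word_dist_zero[OF grp fgs] by (simp add: q_def C_def quotient_dist_def)
  have qc: "q N x y = q N y x" if "N \<in> Ns" "x \<in> C N" "y \<in> C N" for N x y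
    using that group.word_dist_commute[OF grp fgs] by (simp add: q_def C_def quotient_dist_def)
  have qt: "q N x z \<le> q N x y + q N y z" if "N \<in> Ns" "x \<in> C N" "y \<in> C N" "z \<in> C N" for N x y z
    using that group.word_dist_triangle[OF grp fgs] by (simp add: q_def C_def quotient_dist_def)
  have qn: "0 \<le> q N x y" for N x y by (simp add: q_def quotient_dist_def word_dist_def)
  have finC: "finite (C N)" if "N \<in> Ns" for N
    using that by (simp add: Ns_def finite_index_normals_def C_def FactGroup_def)
  have qD: "q N x y \<le> D N" if "N \<in> Ns" "x \<in> C N" "y \<in> C N" for N x y
    unfolding D_def using that finC by (intro Max_ge) auto
  have neC: "\<one>\<^bsub>G Mod N\<^esub> \<in> C N" if "N \<in> Ns" for N
    using grp[OF that] by (simp add: C_def group.is_monoid monoid.one_closed del: one_FactGroup)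
  have Dn: "0 \<le> D N" if "N \<in> Ns" for N
    using qD[OF that neC[OF that] neC[OF that]] qn by (meson order_trans)
  have D0: "N = carrier G" if N: "N \<in> Ns" and "D N = 0" for N
  proof -
    have sub: "subgroup N G" using N
      by (auto simp: Ns_def finite_index_normals_def normal_imp_subgroup)
    have "x = y" if "x \<in> C N" "y \<in> C N" for x y
      using qD[OF N that] q0[OF N that] qn[of N x y] \<open>D N = 0\<close> by simp
    then have "N #> g = N" if "g \<in> carrier G" for g
      using that neC[OF N] by (auto simp: C_def carrier_FactGroup)
    then show ?thesis
      using rcos_self[OF _ sub] subgroup.subset[OF sub] by blast
  qed
  have Dpos: "0 < D N + D N'" if "N \<in> Ns" "N' \<in> Ns" "N \<noteq> N'" for N N'
    using Dn[OF that(1)] Dn[OF that(2)] D0[OF that(1)] D0[OF that(2)] that(3)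
    by (metis add_nonneg_eq_0_iff add_nonneg_nonneg order_le_less)
  have met: "Metric_space M d"
  proof
    fix a b :: "'a set \<times> 'a set"
    obtain N x where a: "a = (N, x)" by fastforce
    obtain N' y where b: "b = (N', y)" by fastforce
    show "0 \<le> d a b" using Dn qn by (auto simp: d_def a b M_iff)
    show "d a b = d b a" using qc by (auto simp: d_def a b M_iff)
    show "d a b = 0 \<longleftrightarrow> a = b" if "a \<in> M" "b \<in> M"
      using that q0 Dpos[of N N'] by (cases "N = N'") (auto simp: d_def a b M_iff)
    fix c assume m: "a \<in> M" "b \<in> M" "c \<in> M"
    obtain N'' z where c: "c = (N'', z)" by fastforce
    have "q N x z \<le> D N" if "N'' = N"
      using m that qD by (auto simp: a c M_iff)
    moreover have "0 \<le> D N" "0 \<le> D N'" "0 \<le> D N''" using m Dn by (auto simp: a b c M_iff)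
    moreover have "0 \<le> q N x y" "0 \<le> q N' y z" using qn by auto
    ultimately show "d a c \<le> d a b + d b c"
      using m qt[of N x y z] by (auto simp: d_def a b c M_iff)
  qed
  have ms: "mspace (metric (M, d)) = M" and md: "mdist (metric (M, d)) = d"
    using met by (simp_all add: Metric_space.mspace_metric Metric_space.mdist_metric)
  have diam: "mdiam (metric (M, d)) (box_component G N) \<le> D N" if N: "N \<in> Ns" for N
    unfolding mdiam_def md
  proof (rule cSUP_least)
    show "box_component G N \<times> box_component G N \<noteq> {}"
      using neC[OF N] by (auto simp: box_component_def C_def)
  qed (use N qD in \<open>auto simp: box_component_def d_def M_iff C_def\<close>)
  have "full_box_space G S (metric (M, d))"
    unfolding full_box_space_def ms md
  proof (intro conjI ballI impI)
    fix N N' a b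
    assume "N \<in> finite_index_normals G" "N' \<in> finite_index_normals G" "N \<noteq> N'"
      "a \<in> box_component G N" "b \<in> box_component G N'"
    then have NN: "N \<in> Ns" "N' \<in> Ns" and "d a b = D N + D N'"
      by (auto simp: Ns_def d_def M_iff box_component_def C_def)
    then show "max (mdiam (metric (M, d)) (box_component G N))
        (mdiam (metric (M, d)) (box_component G N')) \<le> d a b"
      using diam[OF NN(1)] diam[OF NN(2)] Dn[OF NN(1)] Dn[OF NN(2)] by simp
  qed (auto simp: M_def Ns_def d_def M_iff C_def q_def box_component_def)
  then show ?thesis ..
qed

end

end

theory Submission
  imports Defs
begin

text \<open>
  The box space of the plane lattice contains arbitrarily long cycles, the quotients by the
  lattices of all \<open>(x, y)\<close> with \<open>2 * m dvd y\<close>, in which balls of radius \<open>r\<close> have \<open>O(r)\<close> points. On the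
  other hand, if a normal subgroup \<open>N\<close> of \<open>G_group\<close> contains a nonzero translation of sup norm at
  most \<open>M\<close>, then invariance under the dihedral group forces it to contain all translations by
  multiples of \<open>2 * a\<close> for some \<open>1 \<le> a \<le> M\<close>, which leaves only finitely many \<open>N\<close>. For every other
  \<open>N\<close>, balls of radius \<open>O(M)\<close> in \<open>G/N\<close> have at least \<open>(M + 1)^2\<close> points. A coarse equivalence
  \<open>f\<close> sends a point of some long cycle into a component of the second kind. Following a path there by
  points of the image of \<open>f\<close> shows that preimages of balls are contained in balls of linearly larger
  radius, so linear growth of the cycle contradicts quadratic growth of the component.
\<close>

section \<open>Coarse embeddings and distances between components of a box space\<close>

lemma coarse_embedding_preimage_bound:
  assumes "coarse_embedding X Y f"
  obtains L where "L \<ge> 0" "\<And>x y. x \<in> mspace X \<Longrightarrow> y \<in> mspace X \<Longrightarrow> mdist Y (f x) (f y) \<le> s \<Longrightarrow> mdist X x y \<le> L"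
proof (rule ccontr)
  assume "\<not> thesis"
  \<comment> \<open>If no bound worked, each natural number \<open>n\<close> would fail as one. The
    failures form two sequences that diverge from each other in \<open>X\<close> while their images
    stay within \<open>s\<close>, which a coarse embedding forbids.\<close>
  with that have "\<exists>x y. x \<in> mspace X \<and> y \<in> mspace X \<and> mdist Y (f x) (f y) \<le> s \<and> real n < mdist X x y" for n
    by (meson not_le of_nat_0_le_iff)
  then obtain x y where xy: "\<And>n. x n \<in> mspace X" "\<And>n. y n \<in> mspace X"
    "\<And>n. mdist Y (f (x n)) (f (y n)) \<le> s" "\<And>n. real n < mdist X (x n) (y n)"
    by metis
  have "filterlim (\<lambda>n. mdist X (x n) (y n)) at_top sequentially"
    by (rule filterlim_at_top_mono[OF filterlim_real_sequentially])
      (simp add: xy(4) less_imp_le)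
  then have "filterlim (\<lambda>n. mdist Y (f (x n)) (f (y n))) at_top sequentially"
    using assms xy(1,2) unfolding coarse_embedding_def by (auto simp: image_subset_iff)
  then have "eventually (\<lambda>n. s + 1 \<le> mdist Y (f (x n)) (f (y n))) sequentially"
    by (simp add: filterlim_at_top)
  then obtain n where "s + 1 \<le> mdist Y (f (x n)) (f (y n))"
    by (auto simp: eventually_sequentially)
  with xy(3)[of n] show False by simp
qed

lemma mspace_full_box_space_iff:
  assumes "full_box_space G S m"
  shows "p \<in> mspace m \<longleftrightarrow> (\<exists>N\<in>finite_index_normals G. \<exists>g\<in>carrier G. p = (N, N #>\<^bsub>G\<^esub> g))"
  using assms by (auto simp: full_box_space_def box_component_def carrier_FactGroup)

lemma mdist_full_box_space:
  assumes "full_box_space G S m" "N \<in> finite_index_normals G" "g \<in> carrier G" "h \<in> carrier G"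
  shows "mdist m (N, N #>\<^bsub>G\<^esub> g) (N, N #>\<^bsub>G\<^esub> h) = quotient_dist G S N (N #>\<^bsub>G\<^esub> g) (N #>\<^bsub>G\<^esub> h)"
  using assms by (auto simp: full_box_space_def carrier_FactGroup)

lemma finite_box_component:
  "N \<in> finite_index_normals G \<Longrightarrow> finite (box_component G N)"
  by (auto simp: finite_index_normals_def box_component_def FactGroup_def)

text \<open>Distinct components are at least a diameter apart. Consequently a ball that misses some
  point of the component of its centre cannot reach any other component.\<close>

lemma mdist_le_other_component:
  assumes box: "full_box_space G S m"
    and "N \<in> finite_index_normals G" "p \<in> box_component G N" "q \<in> box_component G N"
    and "r \<in> mspace m" "r \<notin> box_component G N"
  shows "mdist m p q \<le> mdist m p r"
proof -
  \<comment> \<open>Finiteness of the component makes the supremum in \<open>mdiam\<close> bounded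
    above, so it dominates each single distance.\<close>
  have "mdist m p q \<le> mdiam m (box_component G N)"
    unfolding mdiam_def
    using assms finite_box_component[OF assms(2)]
    by (intro cSUP_upper2[where x = "(p, q)"]) auto
  also have "mdiam m (box_component G N) \<le> mdist m p r"
  proof -
    obtain N' where N': "N' \<in> finite_index_normals G" "r \<in> box_component G N'"
      using assms(5) box by (auto simp: full_box_space_def)
    then have "N \<noteq> N'" using assms(6) by auto
    then have "max (mdiam m (box_component G N)) (mdiam m (box_component G N')) \<le> mdist m p r"
      using box assms(2,3) N' by (simp add: full_box_space_def)
    then show ?thesis by simp
  qed
  finally show ?thesis .
qed

section \<open>Words, distances in quotients, and lifting of paths\<close>

context group
begin

lemma word_value_FactGroup:
  assumes "N \<lhd> G" "set ws \<subseteq> carrier G"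
  shows "word_value (G Mod N) (map ((#>) N) ws) = N #> word_value G ws"
  using assms(2)
proof (induction ws)
  case Nil
  then show ?case
    using assms(1) by (simp add: word_value_def normal_imp_subgroup subgroup.subset)
next
  case (Cons w ws)
  interpret N: normal N G by fact
  show ?case
    using Cons word_value_closed[of ws] by (simp add: word_value_def N.rcos_sum)
qed

lemma FactGroup_hom:
  assumes "N \<lhd> G"
  shows "group_hom G (G Mod N) ((#>) N)"
  using assms normal.factorgroup_is_group[OF assms] normal.r_coset_hom_Mod[OF assms]
  by (simp add: group_hom_def group_hom_axioms_def group_axioms)

lemma quotient_dist_word_le:
  assumes "N \<lhd> G" "S \<subseteq> carrier G" "g \<in> carrier G" "set ws \<subseteq> S \<union> m_inv G ` S"
  shows "quotient_dist G S N (N #> g) (N #> (g \<otimes> word_value G ws)) \<le> length ws"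
proof -
  interpret q: group_hom G "G Mod N" "(#>) N" by (rule FactGroup_hom) fact
  have ws: "set ws \<subseteq> carrier G" using assms(2,4) by auto
  note w = word_value_closed[OF ws]
  have "inv\<^bsub>G Mod N\<^esub> (N #> g) \<otimes>\<^bsub>G Mod N\<^esub> (N #> (g \<otimes> word_value G ws)) = N #> word_value G ws"
    using assms(3) w q.hom_closed[OF assms(3)] q.hom_closed[OF w]
    by (simp flip: q.hom_inv q.hom_mult add: m_assoc[symmetric] del: mult_FactGroup)
  also have "\<dots> = word_value (G Mod N) (map ((#>) N) ws)"
    using word_value_FactGroup[OF assms(1) ws] by simp
  finally have eq: "inv\<^bsub>G Mod N\<^esub> (N #> g) \<otimes>\<^bsub>G Mod N\<^esub> (N #> (g \<otimes> word_value G ws)) = \<dots>" .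
  have "set (map ((#>) N) ws) \<subseteq> ((#>) N) ` S \<union> m_inv (G Mod N) ` ((#>) N) ` S"
  proof
    fix c assume "c \<in> set (map ((#>) N) ws)"
    then obtain w where w: "c = N #> w" "w \<in> S \<union> m_inv G ` S" using assms(4) by auto
    then show "c \<in> ((#>) N) ` S \<union> m_inv (G Mod N) ` ((#>) N) ` S"
      using q.hom_inv assms(2) by blast
  qed
  from q.H.word_length_le[OF this] show ?thesis
    unfolding quotient_dist_def word_dist_def eq by simp
qed

text \<open>A shortest word over the images of the generators lifts letter by letter, since the
  projection commutes with inverses. Distances in \<open>G Mod N\<close> are thus realised by words
  of \<open>G\<close> itself, which can be evaluated independently of \<open>N\<close>.\<close>

lemma quotient_dist_word:
  assumes "finite_generating_set G S" "N \<lhd> G" "g \<in> carrier G" "h \<in> carrier G"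
  obtains ws where "set ws \<subseteq> S \<union> m_inv G ` S"
    "real (length ws) = quotient_dist G S N (N #> g) (N #> h)" "N #> h = N #> (g \<otimes> word_value G ws)"
proof -
  interpret q: group_hom G "G Mod N" "(#>) N" by (rule FactGroup_hom) fact
  let ?T = "((#>) N) ` S" and ?x = "inv\<^bsub>G Mod N\<^esub> (N #> g) \<otimes>\<^bsub>G Mod N\<^esub> (N #> h)"
  have S: "S \<subseteq> carrier G" using assms(1) by (simp add: finite_generating_set_def)
  have xq: "?x = N #> (inv g \<otimes> h)"
    using assms by (simp flip: q.hom_inv q.hom_mult del: mult_FactGroup)
  have x: "?x \<in> carrier (G Mod N)"
    using assms unfolding xq by (intro q.hom_closed) auto
  obtain ws' where ws': "length ws' = word_length (G Mod N) ?T ?x"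
     "set ws' \<subseteq> ?T \<union> m_inv (G Mod N) ` ?T" "word_value (G Mod N) ws' = ?x"
    using q.H.word_length_word[OF finite_generating_set_quotient[OF assms(1,2)] x] by metis
  have "?T \<union> m_inv (G Mod N) ` ?T = ((#>) N) ` (S \<union> m_inv G ` S)"
    unfolding image_Un image_image using S q.hom_inv
    by (intro arg_cong2[where f = "(\<union>)"] image_cong) auto
  then have "ws' \<in> lists (((#>) N) ` (S \<union> m_inv G ` S))"
    using ws'(2) by auto
  then obtain ws where ws: "ws' = map ((#>) N) ws" "set ws \<subseteq> S \<union> m_inv G ` S"
    unfolding lists_image by auto
  have wc: "set ws \<subseteq> carrier G" using ws(2) S by auto
  note w = word_value_closed[OF wc]
  have eq: "N #> (inv g \<otimes> h) = N #> word_value G ws"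
    using ws'(3) word_value_FactGroup[OF assms(2) wc] unfolding xq ws(1) by simp
  have "N #> h = N #> (g \<otimes> (inv g \<otimes> h))"
    using assms by (simp add: m_assoc[symmetric])
  also have "\<dots> = (N #> g) \<otimes>\<^bsub>G Mod N\<^esub> (N #> (inv g \<otimes> h))"
    using assms by (intro q.hom_mult) auto
  also have "\<dots> = N #> (g \<otimes> word_value G ws)"
    unfolding eq using assms w by (intro q.hom_mult[symmetric]) auto
  finally show ?thesis
    using that[of ws] ws ws'(1) by (simp add: quotient_dist_def word_dist_def)
qed

text \<open>All of \<open>A\<close> is reached from one of its points by words of length at most
  \<open>r\<close>. The resulting bound does not involve \<open>N\<close>, so one constant serves
  all components of the box space.\<close>

lemma card_le_words:
  assumes gen: "finite_generating_set G S" and "N \<lhd> G" "A \<subseteq> carrier (G Mod N)"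
    and close: "\<And>x y. x \<in> A \<Longrightarrow> y \<in> A \<Longrightarrow> quotient_dist G S N x y \<le> r"
  shows "card A \<le> card {ws. set ws \<subseteq> S \<union> m_inv G ` S \<and> length ws \<le> nat \<lfloor>r\<rfloor>}" (is "_ \<le> card ?W")
proof (cases "A = {}")
  case False
  then obtain x where "x \<in> A" by auto
  then obtain g where g: "g \<in> carrier G" "x = N #> g"
    using assms(3) by (auto simp: carrier_FactGroup)
  have "A \<subseteq> (\<lambda>ws. N #> (g \<otimes> word_value G ws)) ` ?W"
  proof
    fix y assume y: "y \<in> A"
    then obtain h where h: "h \<in> carrier G" "y = N #> h"
      using assms(3) by (auto simp: carrier_FactGroup)
    obtain ws where "set ws \<subseteq> S \<union> m_inv G ` S"
      "real (length ws) = quotient_dist G S N (N #> g) (N #> h)" "N #> h = N #> (g \<otimes> word_value G ws)"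
      using quotient_dist_word[OF gen assms(2) g(1) h(1)] by metis
    moreover have "quotient_dist G S N (N #> g) (N #> h) \<le> r"
      using close[OF \<open>x \<in> A\<close> y] g h by simp
    ultimately show "y \<in> (\<lambda>ws. N #> (g \<otimes> word_value G ws)) ` ?W"
      using h by (auto intro!: image_eqI[of _ _ ws] simp: le_nat_floor)
  qed
  moreover have "finite ?W"
    using gen by (intro finite_lists_length_le) (auto simp: finite_generating_set_def)
  ultimately show ?thesis by (meson card_image_le card_mono finite_imageI order_trans)
qed auto

text \<open>
  Every step of a path in a component of the box space is followed by a step of length at most
  \<open>L\<close> in \<open>X\<close>, so that word lengths are distorted only linearly.
\<close>

lemma coarse_lift_word:
  assumes "N \<in> finite_index_normals G" "S \<subseteq> carrier G" "full_box_space G S m"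
    and f: "f ` mspace X \<subseteq> mspace m"
    and surj: "\<And>p. p \<in> mspace m \<Longrightarrow> \<exists>x\<in>mspace X. mdist m (f x) p \<le> R" and "R \<ge> 0"
    and L: "\<And>x y. x \<in> mspace X \<Longrightarrow> y \<in> mspace X \<Longrightarrow> mdist m (f x) (f y) \<le> 2 * R + 1 \<Longrightarrow> mdist X x y \<le> L"
    and x: "x \<in> mspace X" "f x = (N, N #> g)" "g \<in> carrier G"
    and "set ws \<subseteq> S \<union> m_inv G ` S"
  shows "\<exists>y\<in>mspace X. mdist X x y \<le> L * length ws \<and> mdist m (f y) (N, N #> (g \<otimes> word_value G ws)) \<le> R"
  using assms(11)
\<comment> \<open>The metric is that of right multiplication by generators, so a path is extended by
  appending a letter at the end of the word.\<close>
proof (induction ws rule: rev_induct)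
  case Nil
  have "f x \<in> mspace m" using f x(1) by auto
  then have z: "mdist m (f x) (f x) = 0" "mdist X x x = 0"
    using x(1) by simp_all
  have "mdist m (f x) (f x) \<le> R" "mdist X x x \<le> L * length []"
    unfolding z using \<open>R \<ge> 0\<close> by simp_all
  with x show ?case
    by (intro bexI[of _ x] conjI) (simp_all add: word_value_def)
next
  case (snoc t ws)
  have N: "N \<lhd> G" using assms(1) by (simp add: finite_index_normals_def)
  have c: "t \<in> carrier G" "set ws \<subseteq> carrier G" using snoc.prems assms(2) by auto
  define h where "h = g \<otimes> word_value G ws"
  have h: "h \<in> carrier G" using word_value_closed[OF c(2)] x by (simp add: h_def)
  have h': "g \<otimes> word_value G (ws @ [t]) = h \<otimes> t"
    using c x word_value_closed[OF c(2)] by (simp add: h_def word_value_append m_assoc) (simp add: word_value_def)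
  from snoc obtain y where y: "y \<in> mspace X" "mdist X x y \<le> L * length ws" "mdist m (f y) (N, N #> h) \<le> R"
    by (auto simp: h_def)
  have p: "(N, N #> h) \<in> mspace m" "(N, N #> (h \<otimes> t)) \<in> mspace m"
    using mspace_full_box_space_iff[OF assms(3)] assms(1) h c by auto
  then obtain z where z: "z \<in> mspace X" "mdist m (f z) (N, N #> (h \<otimes> t)) \<le> R"
    using surj by blast
  have fyz: "f y \<in> mspace m" "f z \<in> mspace m" using f y z by auto
  have "mdist m (N, N #> h) (N, N #> (h \<otimes> t)) \<le> 1"
    using quotient_dist_word_le[OF N assms(2) h, of "[t]"] snoc.prems c
      mdist_full_box_space[OF assms(3,1) h, of "h \<otimes> t"] h by (simp add: word_value_def)
  \<comment> \<open>At most \<open>R\<close> from \<open>f y\<close> to the path, at most 1 along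
    it, and at most \<open>R\<close> from the path to \<open>f z\<close>.\<close>
  then have "mdist m (f y) (f z) \<le> 2 * R + 1"
    using mdist_triangle[OF fyz(1) p(1) fyz(2)] mdist_triangle[OF p(1) p(2) fyz(2)] y(3) z(2)
      mdist_commute[of m "f z" "(N, N #> (h \<otimes> t))"] by linarith
  from L[OF y(1) z(1) this] have "mdist X x z \<le> L * length (ws @ [t])"
    using mdist_triangle[OF x(1) y(1) z(1)] y(2) by (simp add: algebra_simps)
  with z h' show ?case by auto
qed

end

section \<open>Long cycles in the box space of the plane lattice\<close>

lemma vec2_eq_iff: "(v :: 'a ^ 2) = w \<longleftrightarrow> v $ 1 = w $ 1 \<and> v $ 2 = w $ 2"
  by (auto simp: vec_eq_iff forall_2)

interpretation Z2: group Z2_group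
  by (rule group_Z2_group)

lemma Z2_group_simps [simp]:
  "carrier Z2_group = UNIV" "v \<otimes>\<^bsub>Z2_group\<^esub> w = v + w" "\<one>\<^bsub>Z2_group\<^esub> = 0"
  by (simp_all add: Z2_group_def)

lemma inv_Z2_group [simp]: "inv\<^bsub>Z2_group\<^esub> v = - v"
  by (rule Z2.inv_equality) simp_all

text \<open>For \<open>m > 0\<close> the quotient is cyclic of order \<open>2 * m\<close>; the even
  order provides an exact antipode of 0.\<close>

definition strip_lattice :: "nat \<Rightarrow> (int ^ 2) set" where
  "strip_lattice m = {v. 2 * int m dvd v $ 2}"

text \<open>The map \<open>strip_point m\<close> wraps the integers around the cycle, so points are
  handled through a second coordinate modulo \<open>2 * m\<close> instead of through chosen
  representatives.\<close>

definition strip_point :: "nat \<Rightarrow> int \<Rightarrow> (int ^ 2) set \<times> (int ^ 2) set" where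
  "strip_point m j = (strip_lattice m, {v. 2 * int m dvd v $ 2 - j})"

lemma strip_lattice_coset: "strip_lattice m #>\<^bsub>Z2_group\<^esub> g = {v. 2 * int m dvd v $ 2 - g $ 2}"
proof -
  have "v \<in> strip_lattice m #>\<^bsub>Z2_group\<^esub> g" if "2 * int m dvd v $ 2 - g $ 2" for v
    unfolding r_coset_def strip_lattice_def using that
    by (intro UN_I[of "v - g"]) auto
  then show ?thesis
    by (auto simp: r_coset_def strip_lattice_def)
qed

lemma strip_point_eq_iff:
  "strip_point m i = strip_point m j \<longleftrightarrow> 2 * int m dvd i - j"
proof
  assume "strip_point m i = strip_point m j"
  then have *: "{v::int^2. 2 * int m dvd v $ 2 - i} = {v. 2 * int m dvd v $ 2 - j}"
    by (simp add: strip_point_def)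
  have "vector [0, i] \<in> {v::int^2. 2 * int m dvd v $ 2 - i}" by simp
  then show "2 * int m dvd i - j" unfolding * by simp
next
  assume d: "2 * int m dvd i - j"
  have "2 * int m dvd k - i \<longleftrightarrow> 2 * int m dvd k - j" for k
    using dvd_add_left_iff[OF d, of "k - i"] by simp
  then show "strip_point m i = strip_point m j" by (simp add: strip_point_def)
qed

lemma strip_lattice_inj:
  assumes "strip_lattice m = strip_lattice n" shows "m = n"
proof -
  have *: "2 * int m dvd j \<longleftrightarrow> 2 * int n dvd j" for j
  proof -
    have "vector [0, j] \<in> strip_lattice m \<longleftrightarrow> vector [0, j] \<in> strip_lattice n" using assms by simp
    then show ?thesis by (simp add: strip_lattice_def)
  qed
  show ?thesis using *[of "2 * int m"] *[of "2 * int n"] zdvd_antisym_nonneg[of "2 * int m" "2 * int n"] by simp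
qed

lemma strip_lattice_finite_index:
  assumes "m > 0"
  shows "strip_lattice m \<in> finite_index_normals Z2_group"
proof -
  have sub: "subgroup (strip_lattice m) Z2_group"
    by (rule Z2.subgroupI) (auto simp: strip_lattice_def intro: exI[of _ 0])
  have "strip_lattice m \<lhd> Z2_group"
    unfolding Z2.normal_inv_iff using sub by (auto simp: algebra_simps)
  moreover have "rcosets\<^bsub>Z2_group\<^esub> (strip_lattice m) \<subseteq> (\<lambda>j. snd (strip_point m j)) ` {0..<2 * int m}"
  proof
    fix C assume "C \<in> rcosets\<^bsub>Z2_group\<^esub> (strip_lattice m)"
    then obtain g :: "int ^ 2" where "C = snd (strip_point m (g $ 2))"
      by (auto simp: RCOSETS_def strip_lattice_coset strip_point_def)
    also have "strip_point m (g $ 2) = strip_point m (g $ 2 mod (2 * int m))"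
      by (simp add: strip_point_eq_iff minus_mod_eq_mult_div)
    finally show "C \<in> (\<lambda>j. snd (strip_point m j)) ` {0..<2 * int m}"
      using assms by auto
  qed
  ultimately show ?thesis
    using finite_subset[of _ "(\<lambda>j. snd (strip_point m j)) ` {0..<2 * int m}"]
    by (simp add: finite_index_normals_def)
qed

lemma word_value_Z2_bound:
  assumes "set ws \<subseteq> S \<union> m_inv Z2_group ` S" "\<And>s. s \<in> S \<Longrightarrow> \<bar>s $ 2\<bar> \<le> b"
  shows "\<bar>word_value Z2_group ws $ 2\<bar> \<le> b * int (length ws)"
  using assms(1)
proof (induction ws)
  case Nil
  then show ?case by (simp add: word_value_def)
next
  case (Cons w ws)
  then have "\<bar>w $ 2\<bar> \<le> b" using assms(2) by auto
  then show ?case using Cons by (simp add: word_value_def algebra_simps)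
qed

text \<open>
  If \<open>b * r < m\<close>, the ball cannot leave its component: the antipodal point
  \<open>strip_point m m\<close> is farther than \<open>r\<close> away, hence so is every other component.
\<close>

lemma strip_ball:
  assumes gen: "finite_generating_set Z2_group S" and box: "full_box_space Z2_group S X"
  obtains b :: int where "b \<ge> 0" "\<And>m r. real_of_int b * r < real m \<Longrightarrow> m > 0 \<Longrightarrow>
    {y \<in> mspace X. mdist X (strip_point m 0) y \<le> r} \<subseteq>
      strip_point m ` {- \<lfloor>real_of_int b * r\<rfloor>..\<lfloor>real_of_int b * r\<rfloor>}"
proof -
  \<comment> \<open>The largest change of the second coordinate caused by one letter. The inserted 0
    makes the set nonempty and yields \<open>b \<ge> 0\<close>.\<close>
  define b where "b = Max (insert 0 ((\<lambda>s. \<bar>s $ 2\<bar>) ` S))"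
  have fin: "finite S" using gen by (simp add: finite_generating_set_def)
  have b: "\<bar>s $ 2\<bar> \<le> b" if "s \<in> S" for s
    unfolding b_def using fin that by (intro Max_ge) auto
  have b0: "b \<ge> 0" unfolding b_def using fin by (intro Max_ge) auto
  have pt: "strip_point m j = (strip_lattice m, strip_lattice m #>\<^bsub>Z2_group\<^esub> vector [0, j])" for m j
    by (simp add: strip_point_def strip_lattice_coset)
  \<comment> \<open>The second coordinate of a shortest word from 0 to \<open>j\<close> is a
    representative of the class of \<open>j\<close> whose size is controlled by the
    distance.\<close>
  have near: "\<exists>w. real_of_int \<bar>w\<bar> \<le> b * mdist X (strip_point m 0) (strip_point m j) \<and> 2 * int m dvd w - j"
    if "m > 0" for m j
  proof -
    note N = strip_lattice_finite_index[OF that]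
    then have N': "strip_lattice m \<lhd> Z2_group" by (simp add: finite_index_normals_def)
    obtain ws where ws: "set ws \<subseteq> S \<union> m_inv Z2_group ` S"
      "real (length ws) = quotient_dist Z2_group S (strip_lattice m)
         (strip_lattice m #>\<^bsub>Z2_group\<^esub> vector [0, 0]) (strip_lattice m #>\<^bsub>Z2_group\<^esub> vector [0, j])"
      "strip_lattice m #>\<^bsub>Z2_group\<^esub> vector [0, j] =
         strip_lattice m #>\<^bsub>Z2_group\<^esub> (vector [0, 0] \<otimes>\<^bsub>Z2_group\<^esub> word_value Z2_group ws)"
      using Z2.quotient_dist_word[OF gen N', of "vector [0, 0]" "vector [0, j]"] by auto
    have "real (length ws) = mdist X (strip_point m 0) (strip_point m j)"
      unfolding pt ws(2) by (rule mdist_full_box_space[OF box N, symmetric]) auto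
    moreover have "real_of_int \<bar>word_value Z2_group ws $ 2\<bar> \<le> b * real (length ws)"
      using word_value_Z2_bound[OF ws(1) b] by (metis of_int_le_iff of_int_mult of_int_of_nat_eq)
    moreover have "strip_point m j = strip_point m (word_value Z2_group ws $ 2)"
      using ws(3) by (simp add: strip_point_def strip_lattice_coset)
    then have "2 * int m dvd word_value Z2_group ws $ 2 - j"
      using strip_point_eq_iff by metis
    ultimately show ?thesis by metis
  qed
  show thesis
  proof (rule that[OF b0], rule subsetI)
    fix m :: nat and r :: real and y
    assume m: "real_of_int b * r < real m" "m > 0" and "y \<in> {y \<in> mspace X. mdist X (strip_point m 0) y \<le> r}"
    then have y: "y \<in> mspace X" "mdist X (strip_point m 0) y \<le> r" by auto
    note N = strip_lattice_finite_index[OF m(2)]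
    have comp: "box_component Z2_group (strip_lattice m) = range (strip_point m)"
    proof -
      have "strip_point m (g $ 2) = (strip_lattice m, strip_lattice m #>\<^bsub>Z2_group\<^esub> g)" for g
        by (simp add: strip_point_def strip_lattice_coset)
      then show ?thesis
        by (force simp: box_component_def carrier_FactGroup pt)
    qed
    have "y \<in> box_component Z2_group (strip_lattice m)"
    proof (rule ccontr)
      assume "y \<notin> box_component Z2_group (strip_lattice m)"
      then have "mdist X (strip_point m 0) (strip_point m (int m)) \<le> mdist X (strip_point m 0) y"
        using y(1) comp by (intro mdist_le_other_component[OF box N]) auto
      then have far: "mdist X (strip_point m 0) (strip_point m (int m)) \<le> r" using y(2) by simp
      obtain w where w: "real_of_int \<bar>w\<bar> \<le> b * mdist X (strip_point m 0) (strip_point m (int m))"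
        "2 * int m dvd w - int m" using near[OF m(2)] by blast
      \<comment> \<open>An integer congruent to \<open>m\<close> modulo \<open>2 * m\<close> is an
        odd multiple of \<open>m\<close>, so reaching the antipode requires a displacement of at
        least \<open>m\<close>.\<close>
      from w(2) obtain k where "w = int m * (2 * k + 1)"
        by (auto simp: dvd_def algebra_simps)
      then have "\<bar>w\<bar> = int m * \<bar>2 * k + 1\<bar>" by (simp add: abs_mult)
      moreover have "1 \<le> \<bar>2 * k + 1\<bar>" by presburger
      ultimately have "int m \<le> \<bar>w\<bar>"
        using mult_left_mono[of 1 "\<bar>2 * k + 1\<bar>" "int m"] by simp
      then have "real m \<le> real_of_int \<bar>w\<bar>" by linarith
      also have "\<dots> \<le> b * r" using w(1) far b0 by (meson mult_left_mono of_int_0_le_iff order_trans)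
      finally show False using m(1) by simp
    qed
    then obtain j where j: "y = strip_point m j" using comp by auto
    obtain w where w: "real_of_int \<bar>w\<bar> \<le> b * mdist X (strip_point m 0) y" "2 * int m dvd w - j"
      using near[OF m(2), of j] j by blast
    have "real_of_int \<bar>w\<bar> \<le> b * r"
      using w(1) y(2) b0 by (meson mult_left_mono of_int_0_le_iff order_trans)
    then have "w \<in> {- \<lfloor>real_of_int b * r\<rfloor>..\<lfloor>real_of_int b * r\<rfloor>}" by (simp only: atLeastAtMost_iff le_floor_iff) linarith
    moreover have "y = strip_point m w" using w(2) j strip_point_eq_iff by metis
    ultimately show "y \<in> strip_point m ` {- \<lfloor>real_of_int b * r\<rfloor>..\<lfloor>real_of_int b * r\<rfloor>}" by auto
  qed
qed

section \<open>Translations and normal subgroups in the semidirect product\<close>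

interpretation GG: group G_group
  by (rule group_G_group)

lemma G_group_simps:
  "carrier G_group = UNIV \<times> carrier F_group"
  "(v, A) \<otimes>\<^bsub>G_group\<^esub> (w, B) = (v + A *v w, A ** B)"
  "\<one>\<^bsub>G_group\<^esub> = (0, mat 1)"
  by (simp_all add: G_group_def semidirect_product_def Z2_group_def F_group_def)

lemma F_group_mem: "mat 1 \<in> carrier F_group" "refl_mat \<in> carrier F_group" "swap_mat \<in> carrier F_group"
  using generate.one[of GL2Z] by (auto simp: F_group_def intro: generate.incl)

lemma finite_F_group: "finite (carrier F_group)"
  using card_F_group by (metis card.infinite zero_neq_numeral)

lemma translation_carrier: "(v, mat 1) \<in> carrier G_group"
  by (simp add: G_group_simps F_group_mem)

lemma translation_mult: "(v, mat 1) \<otimes>\<^bsub>G_group\<^esub> (w, A) = (v + w, A)"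
  by (simp add: G_group_simps)

lemma translation_inv: "inv\<^bsub>G_group\<^esub> (v, mat 1) = (- v, mat 1)"
  by (rule GG.inv_equality) (simp_all add: translation_mult translation_carrier, simp add: G_group_simps)

text \<open>Conjugating a translation by \<open>(0, A)\<close> applies \<open>A\<close> to its
  vector, so the translation vectors of a normal subgroup are invariant under the dihedral
  group.\<close>

lemma normal_translation_mult:
  assumes N: "N \<lhd> G_group" and v: "(v, mat 1) \<in> N" and A: "A \<in> carrier F_group"
  shows "(A *v v, mat 1) \<in> N"
proof -
  let ?g = "(0, A)"
  have g: "?g \<in> carrier G_group" using A by (simp add: G_group_simps)
  have "(A *v v, mat 1) \<otimes>\<^bsub>G_group\<^esub> ?g = ?g \<otimes>\<^bsub>G_group\<^esub> (v, mat 1)"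
    by (simp add: G_group_simps)
  then have "(A *v v, mat 1) = ?g \<otimes>\<^bsub>G_group\<^esub> (v, mat 1) \<otimes>\<^bsub>G_group\<^esub> inv\<^bsub>G_group\<^esub> ?g"
    using GG.inv_solve_right[OF translation_carrier GG.m_closed[OF g translation_carrier] g] by metis
  then show ?thesis using normal.inv_op_closed2[OF N g v] by simp
qed

text \<open>Adding \<open>(x, y)\<close> to its reflection \<open>(x, -y)\<close> gives
  \<open>(2 * x, 0)\<close>, and swapping gives \<open>(0, 2 * x)\<close>; together they generate
  all multiples of \<open>2 * x\<close>. For \<open>a\<close> one takes the absolute value of a
  nonzero coordinate of \<open>u\<close>. Here the symmetry excludes long thin quotients such as the
  cycles above.\<close>

lemma invariant_lattice_contains_square:
  fixes \<Lambda> :: "(int ^ 2) set"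
  assumes add: "\<And>v w. v \<in> \<Lambda> \<Longrightarrow> w \<in> \<Lambda> \<Longrightarrow> v + w \<in> \<Lambda>" and neg: "\<And>v. v \<in> \<Lambda> \<Longrightarrow> - v \<in> \<Lambda>"
    and refl: "\<And>v. v \<in> \<Lambda> \<Longrightarrow> refl_mat *v v \<in> \<Lambda>" and swap: "\<And>v. v \<in> \<Lambda> \<Longrightarrow> swap_mat *v v \<in> \<Lambda>"
    and u: "u \<in> \<Lambda>" "u \<noteq> 0" "\<And>i. \<bar>u $ i\<bar> \<le> M"
  shows "\<exists>a\<in>{1..M}. \<forall>w. (2 * a) *s w \<in> \<Lambda>"
proof -
  have refl': "vector [x, - y] \<in> \<Lambda>" if "vector [x, y] \<in> \<Lambda>" for x y
  proof -
    have "refl_mat *v vector [x, y] = vector [x, - y]"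
      by (simp add: vec2_eq_iff refl_mat_def matrix_vector_mult_def sum_2)
    then show ?thesis using refl[OF that] by simp
  qed
  have swap': "vector [y, x] \<in> \<Lambda>" if "vector [x, y] \<in> \<Lambda>" for x y
  proof -
    have "swap_mat *v vector [x, y] = vector [y, x]"
      by (simp add: vec2_eq_iff swap_mat_def matrix_vector_mult_def sum_2)
    then show ?thesis using swap[OF that] by simp
  qed
  have add': "vector [x + x', y + y'] \<in> \<Lambda>" if "vector [x, y] \<in> \<Lambda>" "vector [x', y'] \<in> \<Lambda>" for x x' y y'
  proof -
    have "vector [x, y] + vector [x', y'] = (vector [x + x', y + y'] :: int ^ 2)" by (simp add: vec2_eq_iff)
    then show ?thesis using add[OF that] by simp
  qed
  have neg': "vector [- x, - y] \<in> \<Lambda>" if "vector [x, y] \<in> \<Lambda>" for x y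
  proof -
    have "- vector [x, y] = (vector [- x, - y] :: int ^ 2)" by (simp add: vec2_eq_iff)
    then show ?thesis using neg[OF that] by simp
  qed
  have square: "(2 * \<bar>x\<bar>) *s w \<in> \<Lambda>" if xy: "vector [x, y] \<in> \<Lambda>" for x y w
  proof -
    have "vector [2 * x, 0] \<in> \<Lambda>" using add'[OF xy refl'[OF xy]] by simp
    then have x: "vector [2 * \<bar>x\<bar>, 0] \<in> \<Lambda>" using neg'[of "2 * x" 0] by (simp add: abs_if)
    have nat: "vector [2 * \<bar>x\<bar> * int k, 0] \<in> \<Lambda>" for k
    proof (induction k)
      case 0
      then show ?case using add'[OF x neg'[OF x]] by simp
    next
      case (Suc k)
      then show ?case using add'[OF x Suc] by (simp add: algebra_simps)
    qed
    have int: "vector [2 * \<bar>x\<bar> * k, 0] \<in> \<Lambda>" for k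
      using nat[of "nat k"] neg'[OF nat[of "nat (- k)"]] by (cases "k \<ge> 0") simp_all
    have "(2 * \<bar>x\<bar>) *s w = vector [2 * \<bar>x\<bar> * w $ 1 + 0, 0 + 2 * \<bar>x\<bar> * w $ 2]"
      by (simp add: vec2_eq_iff)
    also have "\<dots> \<in> \<Lambda>" by (intro add' int swap'[OF int])
    finally show ?thesis .
  qed
  have "vector [u $ 1, u $ 2] = u" by (simp add: vec2_eq_iff)
  then have uv: "vector [u $ 1, u $ 2] \<in> \<Lambda>" using u(1) by simp
  show ?thesis
  proof (cases "u $ 1 = 0")
    case True
    then have "u $ 2 \<noteq> 0" using u(2) by (simp add: vec2_eq_iff)
    then show ?thesis using square[OF swap'[OF uv]] u(3)[of 2] by (intro bexI[of _ "\<bar>u $ 2\<bar>"]) auto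
  next
    case False
    then show ?thesis using square[OF uv] u(3)[of 1] by (intro bexI[of _ "\<bar>u $ 1\<bar>"]) auto
  qed
qed

definition normals_containing_square :: "int \<Rightarrow> ((int ^ 2) \<times> (int ^ 2 ^ 2)) set set" where
  "normals_containing_square a = {N. N \<lhd> G_group \<and> (\<forall>w. ((2 * a) *s w, mat 1) \<in> N)}"

lemma normal_short_translation:
  assumes N: "N \<lhd> G_group" and "(u, mat 1) \<in> N" "u \<noteq> 0" "\<And>i. \<bar>u $ i\<bar> \<le> M"
  shows "N \<in> (\<Union>a\<in>{1..M}. normals_containing_square a)"
proof -
  interpret N: normal N G_group by fact
  have "\<exists>a\<in>{1..M}. \<forall>w. (2 * a) *s w \<in> {v. (v, mat 1) \<in> N}"
  proof (rule invariant_lattice_contains_square)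
    show "v + w \<in> {v. (v, mat 1) \<in> N}" if "v \<in> {v. (v, mat 1) \<in> N}" "w \<in> {v. (v, mat 1) \<in> N}" for v w
      using that N.m_closed[of "(v, mat 1)" "(w, mat 1)"] by (simp add: translation_mult)
    show "- v \<in> {v. (v, mat 1) \<in> N}" if "v \<in> {v. (v, mat 1) \<in> N}" for v
      using that N.m_inv_closed[of "(v, mat 1)"] by (simp add: translation_inv)
  qed (use assms normal_translation_mult[OF N] F_group_mem in auto)
  then show ?thesis using N by (auto simp: normals_containing_square_def)
qed

text \<open>Membership in \<open>N\<close> depends on the translation part only modulo
  \<open>2 * a\<close>. Hence \<open>N\<close> is determined by its intersection with a fixed finite
  set \<open>B\<close> of reduced elements.\<close>

lemma finite_normals_containing_square:
  assumes "a > 0"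
  shows "finite (normals_containing_square a)"
proof -
  define red :: "int ^ 2 \<Rightarrow> int ^ 2" where "red v = vector [v $ 1 mod (2 * a), v $ 2 mod (2 * a)]" for v
  have red_in: "(v, A) \<in> N \<longleftrightarrow> (red v, A) \<in> N" if "N \<in> normals_containing_square a" for N v A
  proof -
    define w :: "int ^ 2" where "w = vector [v $ 1 div (2 * a), v $ 2 div (2 * a)]"
    have v: "v = (2 * a) *s w + red v"
      by (simp add: vec2_eq_iff w_def red_def)
    then have r: "red v = (2 * a) *s (- w) + v" by (simp add: vec2_eq_iff)
    have N: "N \<lhd> G_group" and sq: "((2 * a) *s w, mat 1) \<in> N" for w
      using that by (auto simp: normals_containing_square_def)
    interpret N: normal N G_group by fact
    show ?thesis
      using N.m_closed[OF sq, of "(red v, A)" w] N.m_closed[OF sq, of "(v, A)" "- w"]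
      unfolding translation_mult v[symmetric] r[symmetric] by blast
  qed
  define B where "B = range red \<times> carrier F_group"
  have "red v \<in> (\<lambda>(x, y). vector [x, y]) ` ({0..<2 * a} \<times> {0..<2 * a})" for v
    using assms by (auto simp: red_def)
  then have "finite (range red)" by (meson finite_SigmaI finite_atLeastLessThan_int finite_imageI finite_subset image_subsetI)
  then have "finite B" using finite_F_group by (simp add: B_def)
  moreover have "inj_on (\<lambda>N. N \<inter> B) (normals_containing_square a)"
  proof (rule inj_onI)
    fix N N' assume NN: "N \<in> normals_containing_square a" "N' \<in> normals_containing_square a" "N \<inter> B = N' \<inter> B"
    have sub: "N \<subseteq> carrier G_group" "N' \<subseteq> carrier G_group"
      using NN(1,2) by (simp_all add: normals_containing_square_def normal_imp_subgroup subgroup.subset)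
    have "(v, A) \<in> N \<longleftrightarrow> (v, A) \<in> N'" for v A
    proof (cases "A \<in> carrier F_group")
      case True
      then have "(red v, A) \<in> B" by (simp add: B_def)
      then show ?thesis using red_in[OF NN(1)] red_in[OF NN(2)] NN(3) by blast
    qed (use sub in \<open>auto simp: G_group_simps\<close>)
    then show "N = N'" by auto
  qed
  moreover have "(\<lambda>N. N \<inter> B) ` normals_containing_square a \<subseteq> Pow B" by blast
  ultimately show ?thesis
    using inj_on_finite finite_Pow_iff by metis
qed

text \<open>If two of these cosets agreed, conjugating by \<open>g\<close> would put the translation
  by \<open>v - w\<close>, of sup norm at most \<open>M\<close>, into \<open>N\<close>. This gives
  quadratically many points around any base point of a component that is not exceptional.\<close>

lemma translation_cosets_inj:
  assumes N: "N \<lhd> G_group" "N \<notin> (\<Union>a\<in>{1..M}. normals_containing_square a)" and g: "g \<in> carrier G_group"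
  shows "inj_on (\<lambda>v. N #>\<^bsub>G_group\<^esub> (g \<otimes>\<^bsub>G_group\<^esub> (v, mat 1))) {v. \<forall>i. v $ i \<in> {0..M}}"
proof (rule inj_onI)
  fix v w :: "int ^ 2"
  assume vw: "v \<in> {v. \<forall>i. v $ i \<in> {0..M}}" "w \<in> {v. \<forall>i. v $ i \<in> {0..M}}"
    "N #>\<^bsub>G_group\<^esub> (g \<otimes>\<^bsub>G_group\<^esub> (v, mat 1)) = N #>\<^bsub>G_group\<^esub> (g \<otimes>\<^bsub>G_group\<^esub> (w, mat 1))"
  interpret N: normal N G_group by fact
  note t = translation_carrier
  have "g \<otimes>\<^bsub>G_group\<^esub> (v, mat 1) \<in> N #>\<^bsub>G_group\<^esub> (g \<otimes>\<^bsub>G_group\<^esub> (w, mat 1))"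
    using vw(3) GG.rcos_self[OF GG.m_closed[OF g t] N.subgroup_axioms, of v] by simp
  then obtain h where h: "h \<in> N" "g \<otimes>\<^bsub>G_group\<^esub> (v, mat 1) = h \<otimes>\<^bsub>G_group\<^esub> (g \<otimes>\<^bsub>G_group\<^esub> (w, mat 1))"
    by (auto simp: r_coset_def)
  have hc: "h \<in> carrier G_group" using h(1) by simp
  have "(v, mat 1) = inv\<^bsub>G_group\<^esub> g \<otimes>\<^bsub>G_group\<^esub> (h \<otimes>\<^bsub>G_group\<^esub> (g \<otimes>\<^bsub>G_group\<^esub> (w, mat 1)))"
    using h(2) GG.inv_solve_left[OF t g GG.m_closed[OF hc GG.m_closed[OF g t]]] by metis
  also have "\<dots> = (inv\<^bsub>G_group\<^esub> g \<otimes>\<^bsub>G_group\<^esub> h \<otimes>\<^bsub>G_group\<^esub> g) \<otimes>\<^bsub>G_group\<^esub> (w, mat 1)"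
    using g hc t by (simp add: GG.m_assoc)
  finally have "(v, mat 1) \<otimes>\<^bsub>G_group\<^esub> inv\<^bsub>G_group\<^esub> (w, mat 1) = inv\<^bsub>G_group\<^esub> g \<otimes>\<^bsub>G_group\<^esub> h \<otimes>\<^bsub>G_group\<^esub> g"
    using g hc t by (simp add: GG.inv_solve_right')
  then have "(v - w, mat 1) \<in> N"
    using N.inv_op_closed1[OF g h(1)] by (simp add: translation_inv translation_mult)
  moreover have "\<bar>(v - w) $ i\<bar> \<le> M" for i
  proof -
    have "v $ i \<in> {0..M}" "w $ i \<in> {0..M}" using vw(1,2) by auto
    then show ?thesis by auto
  qed
  ultimately show "v = w"
    using normal_short_translation[OF N(1), of "v - w" M] N(2) by auto
qed

lemma translation_words:
  assumes gen: "finite_generating_set G_group T"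
  obtains c :: nat where "\<And>v M. \<forall>i. v $ i \<in> {0..int M} \<Longrightarrow>
    \<exists>ws. set ws \<subseteq> T \<union> m_inv G_group ` T \<and> length ws \<le> c * M \<and> word_value G_group ws = (v, mat 1)"
proof -
  let ?W = "T \<union> m_inv G_group ` T"
  have W: "?W \<subseteq> carrier G_group" using gen by (auto simp: finite_generating_set_def)
  have append: "word_value G_group (us @ ws) = word_value G_group us \<otimes>\<^bsub>G_group\<^esub> word_value G_group ws"
    if "set us \<subseteq> ?W" "set ws \<subseteq> ?W" for us ws
    using GG.word_value_append[OF subset_trans[OF that(1) W] subset_trans[OF that(2) W]] .
  have multiple: "\<exists>ws. set ws \<subseteq> ?W \<and> length ws = k * word_length G_group T (v, mat 1) \<and>
      word_value G_group ws = (int k *s v, mat 1)" for k v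
  proof (induction k)
    case 0
    show ?case by (auto simp: word_value_def G_group_simps)
  next
    case (Suc k)
    then obtain ws where ws: "set ws \<subseteq> ?W" "length ws = k * word_length G_group T (v, mat 1)"
      "word_value G_group ws = (int k *s v, mat 1)" by blast
    obtain us where us: "length us = word_length G_group T (v, mat 1)" "set us \<subseteq> ?W"
      "word_value G_group us = (v, mat 1)"
      using GG.word_length_word[OF gen translation_carrier] by metis
    have "word_value G_group (us @ ws) = (int (Suc k) *s v, mat 1)"
      unfolding append[OF us(2) ws(1)] us(3) ws(3)
      by (simp add: translation_mult vec2_eq_iff algebra_simps)
    with us ws show ?case by (intro exI[of _ "us @ ws"]) (simp add: add.commute)
  qed
  let ?e1 = "vector [1, 0] :: int ^ 2" and ?e2 = "vector [0, 1] :: int ^ 2"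
  \<comment> \<open>A vector of the square is written as at most \<open>M\<close> copies of a
    shortest word for each unit translation, so the cost per unit of \<open>M\<close> is the sum of
    the two lengths.\<close>
  define c where "c = word_length G_group T (?e1, mat 1) + word_length G_group T (?e2, mat 1)"
  have "\<exists>ws. set ws \<subseteq> ?W \<and> length ws \<le> c * M \<and> word_value G_group ws = (v, mat 1)"
    if v: "\<forall>i. v $ i \<in> {0..int M}" for v M
  proof -
    obtain us where us: "set us \<subseteq> ?W" "length us = nat (v $ 1) * word_length G_group T (?e1, mat 1)"
      "word_value G_group us = (int (nat (v $ 1)) *s ?e1, mat 1)" using multiple by blast
    obtain ws where ws: "set ws \<subseteq> ?W" "length ws = nat (v $ 2) * word_length G_group T (?e2, mat 1)"
      "word_value G_group ws = (int (nat (v $ 2)) *s ?e2, mat 1)" using multiple by blast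
    have le: "nat (v $ i) \<le> M" "v $ i \<ge> 0" for i
      using v by (simp_all add: nat_le_iff)
    have "length (us @ ws) \<le> c * M"
      using mult_le_mono1[OF le(1)[of 1], of "word_length G_group T (?e1, mat 1)"]
        mult_le_mono1[OF le(1)[of 2], of "word_length G_group T (?e2, mat 1)"]
      by (simp only: us ws c_def length_append distrib_left mult.commute[of _ M] add_mono)
    moreover have "word_value G_group (us @ ws) = (v, mat 1)"
      unfolding append[OF us(1) ws(1)] us(3) ws(3)
      by (simp add: translation_mult vec2_eq_iff le(2))
    moreover have "set (us @ ws) \<subseteq> ?W" using us(1) ws(1) by simp
    ultimately show ?thesis by blast
  qed
  with that show thesis by blast
qed

section \<open>Counting, and the clash of linear with quadratic growth\<close>

lemma card_int_square: "card {v :: int ^ 2. \<forall>i. v $ i \<in> {0..int M}} = (M + 1)\<^sup>2"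
proof -
  have "{v :: int ^ 2. \<forall>i. v $ i \<in> {0..int M}} = (\<lambda>(x, y). vector [x, y]) ` ({0..int M} \<times> {0..int M})"
  proof -
    have "v \<in> (\<lambda>(x, y). vector [x, y]) ` ({0..int M} \<times> {0..int M})"
      if "\<forall>i. v $ i \<in> {0..int M}" for v :: "int ^ 2"
      by (rule image_eqI[of _ _ "(v $ 1, v $ 2)"]) (use that in \<open>simp_all add: vec2_eq_iff\<close>)
    then show ?thesis by (auto simp: forall_2)
  qed
  moreover have "inj_on (\<lambda>(x, y). vector [x, y] :: int ^ 2) ({0..int M} \<times> {0..int M})"
    by (auto simp: inj_on_def vec2_eq_iff)
  moreover have "nat (int M + 1) = M + 1" by simp
  ultimately show ?thesis
    by (simp add: card_image card_cartesian_product power2_eq_square)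
qed

lemma card_le_fibres:
  assumes "finite A" "\<And>z. z \<in> h ` A \<Longrightarrow> card {x \<in> A. h x = z} \<le> K"
  shows "card A \<le> card (h ` A) * K"
proof -
  have "A = (\<Union>z\<in>h ` A. {x \<in> A. h x = z})" by auto
  then have "card A \<le> (\<Sum>z\<in>h ` A. card {x \<in> A. h x = z})"
    using card_UN_le[of "h ` A" "\<lambda>z. {x \<in> A. h x = z}"] assms(1) by simp
  also have "\<dots> \<le> of_nat (card (h ` A)) * K"
    using assms(2) by (rule sum_bounded_above)
  finally show ?thesis by simp
qed

theorem corollary4:
  fixes S :: "(int ^ 2) set"
    and T :: "((int ^ 2) \<times> (int ^ 2 ^ 2)) set"
    and boxH :: "((int ^ 2) set \<times> (int ^ 2) set) metric"
    and boxG :: "(((int ^ 2) \<times> (int ^ 2 ^ 2)) set \<times> ((int ^ 2) \<times> (int ^ 2 ^ 2)) set) metric"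
  assumes "finite_generating_set Z2_group S"
    and "finite_generating_set G_group T"
    and "full_box_space Z2_group S boxH"
    and "full_box_space G_group T boxG"
  shows "\<not> coarsely_equivalent boxH boxG"
proof
  assume "coarsely_equivalent boxH boxG"
  then obtain f R where emb: "coarse_embedding boxH boxG f" and R: "R \<ge> 0"
    and cover: "mspace boxG = {p \<in> mspace boxG. \<exists>x\<in>mspace boxH. mdist boxG (f x) p \<le> R}"
    by (auto simp: coarsely_equivalent_def coarse_equivalence_def)
  have f: "f ` mspace boxH \<subseteq> mspace boxG" using emb by (simp add: coarse_embedding_def)
  have surj: "\<exists>x\<in>mspace boxH. mdist boxG (f x) p \<le> R" if "p \<in> mspace boxG" for p
    using cover that by blast
  have T: "T \<subseteq> carrier G_group" using assms(2) by (simp add: finite_generating_set_def)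
  obtain L where L0: "L \<ge> 0" and L: "\<And>x y. x \<in> mspace boxH \<Longrightarrow> y \<in> mspace boxH \<Longrightarrow>
      mdist boxG (f x) (f y) \<le> 2 * R + 1 \<Longrightarrow> mdist boxH x y \<le> L"
    using coarse_embedding_preimage_bound[OF emb, of "2 * R + 1"] by blast
  obtain b :: int where b0: "b \<ge> 0" and ball: "\<And>m r. real_of_int b * r < real m \<Longrightarrow> m > 0 \<Longrightarrow>
      {y \<in> mspace boxH. mdist boxH (strip_point m 0) y \<le> r} \<subseteq>
        strip_point m ` {- \<lfloor>real_of_int b * r\<rfloor>..\<lfloor>real_of_int b * r\<rfloor>}"
    using strip_ball[OF assms(1,3)] by blast
  obtain c :: nat where c: "\<And>v M. \<forall>i. v $ i \<in> {0..int M} \<Longrightarrow>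
      \<exists>ws. set ws \<subseteq> T \<union> m_inv G_group ` T \<and> length ws \<le> c * M \<and> word_value G_group ws = (v, mat 1)"
    using translation_words[OF assms(2)] by blast
  \<comment> \<open>Bounds, in every quotient, the size of a set of cosets at mutual distance at
    most \<open>2 * R\<close>; it will bound the fibres of the lifting map.\<close>
  define K where "K = card {ws. set ws \<subseteq> T \<union> m_inv G_group ` T \<and> length ws \<le> nat \<lfloor>2 * R\<rfloor>}"
  \<comment> \<open>Chosen so that linear growth allows at most \<open>M * (M + 1)\<close> points,
    fewer than the \<open>(M + 1)^2\<close> points of the square \<open>V\<close>.\<close>
  define M where "M = nat \<lceil>(2 * b * L * c + 1) * K\<rceil>"
  define V where "V = {v :: int ^ 2. \<forall>i. v $ i \<in> {0..int M}}"
  \<comment> \<open>Words for vectors of \<open>V\<close> have at most \<open>c * M\<close> letters,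
    and lifting a letter costs at most \<open>L\<close>.\<close>
  define r where "r = L * (c * M)"
  have r0: "r \<ge> 0" using L0 by (simp add: r_def)
  \<comment> \<open>From \<open>m0\<close> on the cycles are long enough for \<open>ball\<close> to
    apply with radius \<open>r\<close> and with radius \<open>r + L\<close>; the latter is used for
    \<open>inj\<close>. Adding 1 makes the inequality strict and \<open>m\<close> positive.\<close>
  define m0 where "m0 = nat \<lceil>b * (r + L)\<rceil> + 1"
  have m0: "b * (r + L) < real m" "b * r < real m" "m > 0" if "m \<ge> m0" for m
  proof -
    show "b * (r + L) < real m" using that unfolding m0_def by linarith
    moreover have "b * r \<le> b * (r + L)" using b0 L0 by (intro mult_left_mono) auto
    ultimately show "b * r < real m" by simp
    show "m > 0" using that by (simp add: m0_def)
  qed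
  have strip_mem: "strip_point m 0 \<in> mspace boxH" if "m > 0" for m
    using strip_lattice_finite_index[OF that] strip_lattice_coset[of m 0]
    unfolding mspace_full_box_space_iff[OF assms(3)]
    by (intro bexI[of _ "strip_lattice m"] bexI[of _ 0]) (auto simp: strip_point_def)
  \<comment> \<open>Equal images force the base points to be within \<open>L\<close> of each other,
    hence in the same component, and the lattice determines \<open>m\<close>.\<close>
  have inj: "inj_on (\<lambda>m. f (strip_point m 0)) {m0..}"
  proof (rule inj_onI)
    fix m n assume mn: "m \<in> {m0..}" "n \<in> {m0..}" "f (strip_point m 0) = f (strip_point n 0)"
    have mem: "strip_point m 0 \<in> mspace boxH" "strip_point n 0 \<in> mspace boxH"
      using mn(1,2) m0(3) strip_mem by auto
    then have "mdist boxG (f (strip_point m 0)) (f (strip_point n 0)) = 0"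
      using mn(3) f by (auto simp: image_subset_iff)
    then have "mdist boxH (strip_point m 0) (strip_point n 0) \<le> r + L"
      using L[OF mem] R r0 by simp
    then have "strip_point n 0 \<in> range (strip_point m)"
      using ball[OF m0(1,3), of m] mn(1) mem by blast
    then show "m = n" using strip_lattice_inj by (auto simp: strip_point_def)
  qed
  define bad where "bad = finite_index_normals G_group \<inter> (\<Union>a\<in>{1..int M}. normals_containing_square a)"
  have "finite bad" unfolding bad_def using finite_normals_containing_square by auto
  then have "finite (\<Union>N\<in>bad. box_component G_group N)"
    using finite_box_component by (auto simp: bad_def)
  \<comment> \<open>The exceptional components contain only finitely many points in total, too few
    for infinitely many distinct images.\<close>
  then have "\<not> (\<lambda>m. f (strip_point m 0)) ` {m0..} \<subseteq> (\<Union>N\<in>bad. box_component G_group N)"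
    using inj by (meson finite_imageD finite_subset infinite_Ici)
  then obtain m where m: "m \<ge> m0" "f (strip_point m 0) \<notin> (\<Union>N\<in>bad. box_component G_group N)"
    unfolding image_subset_iff Ball_def atLeast_iff by blast
  let ?x = "strip_point m 0"
  have x: "?x \<in> mspace boxH" using m(1) m0(3) strip_mem by auto
  then have "f ?x \<in> mspace boxG" using f by auto
  then obtain N g where N: "N \<in> finite_index_normals G_group" and g: "g \<in> carrier G_group"
    and fx: "f ?x = (N, N #>\<^bsub>G_group\<^esub> g)"
    unfolding mspace_full_box_space_iff[OF assms(4)] by blast
  have Nn: "N \<lhd> G_group" using N by (simp add: finite_index_normals_def)
  have "f ?x \<in> box_component G_group N"
    using g by (auto simp: fx box_component_def carrier_FactGroup)
  then have good: "N \<notin> (\<Union>a\<in>{1..int M}. normals_containing_square a)"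
    using m(2) N by (auto simp: bad_def)
  define q where "q v = N #>\<^bsub>G_group\<^esub> (g \<otimes>\<^bsub>G_group\<^esub> (v, mat 1))" for v
  have q_inj: "inj_on q V"
    using translation_cosets_inj[OF Nn good g] by (simp add: q_def[abs_def] V_def)
  have q_mem: "q v \<in> carrier (G_group Mod N)" "(N, q v) \<in> mspace boxG" for v
    using GG.m_closed[OF g translation_carrier] N mspace_full_box_space_iff[OF assms(4)]
    by (auto simp: q_def carrier_FactGroup)
  \<comment> \<open>The path spelled by a word for \<open>v\<close>, starting at
    \<open>f ?x\<close>, is followed in \<open>boxH\<close>; its endpoint \<open>q v\<close> is
    shadowed by the image of a point within \<open>r\<close> of \<open>?x\<close>.\<close>
  have "\<exists>y\<in>mspace boxH. mdist boxH ?x y \<le> r \<and> mdist boxG (f y) (N, q v) \<le> R" if v: "v \<in> V" for v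
  proof -
    obtain ws where ws: "set ws \<subseteq> T \<union> m_inv G_group ` T" "length ws \<le> c * M"
      "word_value G_group ws = (v, mat 1)"
      using c[OF v[unfolded V_def mem_Collect_eq]] by blast
    obtain y where y: "y \<in> mspace boxH" "mdist boxH ?x y \<le> L * length ws"
      "mdist boxG (f y) (N, N #>\<^bsub>G_group\<^esub> (g \<otimes>\<^bsub>G_group\<^esub> word_value G_group ws)) \<le> R"
      using GG.coarse_lift_word[OF N T assms(4) f surj R L x fx g ws(1)] by blast
    have "L * length ws \<le> r"
      unfolding r_def using ws(2) L0 by (intro mult_left_mono) (simp_all flip: of_nat_mult)
    with y show ?thesis unfolding q_def ws(3) by (meson order_trans)
  qed
  then obtain y where y: "\<And>v. v \<in> V \<Longrightarrow> y v \<in> mspace boxH" "\<And>v. v \<in> V \<Longrightarrow> mdist boxH ?x (y v) \<le> r"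
    "\<And>v. v \<in> V \<Longrightarrow> mdist boxG (f (y v)) (N, q v) \<le> R"
    by metis
  have finV: "finite V"
    using card_int_square[of M] by (metis V_def card.infinite add_is_0 one_neq_zero power_eq_0_iff)
  \<comment> \<open>Vectors with the same lift \<open>z\<close> have their cosets within
    \<open>R\<close> of \<open>f z\<close>, hence within \<open>2 * R\<close> of each other, and
    \<open>q\<close> is injective on \<open>V\<close>.\<close>
  have fibre: "card {v \<in> V. y v = z} \<le> K" for z
  proof -
    have "card (q ` {v \<in> V. y v = z}) \<le> K"
      unfolding K_def
    proof (rule GG.card_le_words[OF assms(2) Nn])
      fix s t assume "s \<in> q ` {v \<in> V. y v = z}" "t \<in> q ` {v \<in> V. y v = z}"
      then obtain v w where vw: "v \<in> V" "w \<in> V" "y v = z" "y w = z" "s = q v" "t = q w" by auto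
      have fz: "f z \<in> mspace boxG" using vw y(1) f by auto
      have "mdist boxG (N, q v) (N, q w) \<le> 2 * R"
        using mdist_triangle[OF q_mem(2) fz q_mem(2), of v w] y(3)[OF vw(1)] y(3)[OF vw(2)] vw(3,4)
          mdist_commute[of boxG "(N, q v)" "f z"] by simp
      then show "quotient_dist G_group T N s t \<le> 2 * R"
        using assms(4) N q_mem(1) by (simp add: full_box_space_def vw(5,6))
    qed (use q_mem in auto)
    moreover have "inj_on q {v \<in> V. y v = z}" using q_inj by (auto intro: inj_on_subset)
    ultimately show ?thesis by (simp add: card_image)
  qed
  have "y ` V \<subseteq> strip_point m ` {- \<lfloor>real_of_int b * r\<rfloor>..\<lfloor>real_of_int b * r\<rfloor>}"
    using ball[OF m0(2,3)[OF m(1)]] y(1,2) by blast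
  then have "card (y ` V) \<le> card {- \<lfloor>real_of_int b * r\<rfloor>..\<lfloor>real_of_int b * r\<rfloor>}"
    by (meson card_image_le card_mono finite_atLeastAtMost_int finite_imageI order_trans)
  moreover have "b * r \<ge> 0" using b0 r0 by simp
  ultimately have yV: "real (card (y ` V)) \<le> 2 * (b * r) + 1" by simp linarith
  have "(M + 1)\<^sup>2 \<le> card (y ` V) * K"
    using card_le_fibres[OF finV fibre] card_int_square[of M] by (simp add: V_def)
  then have "real ((M + 1)\<^sup>2) \<le> real (card (y ` V) * K)"
    by (rule of_nat_mono)
  then have "(real M + 1)\<^sup>2 \<le> real (card (y ` V)) * K" by (simp add: add.commute)
  also have "\<dots> \<le> (2 * (b * r) + 1) * K" using yV by (rule mult_right_mono) simp
  \<comment> \<open>Since \<open>r\<close> equals \<open>L * c * M\<close>, the left side is linear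
    in \<open>M\<close>; a factor \<open>real M + 1\<close> is split off to be compared with the
    square.\<close>
  also have "\<dots> \<le> ((2 * b * L * c + 1) * (real M + 1)) * K"
  proof (rule mult_right_mono)
    have "0 \<le> b * L * c" using b0 L0 by simp
    then show "2 * (b * r) + 1 \<le> (2 * b * L * c + 1) * (real M + 1)"
      by (simp add: r_def algebra_simps)
  qed simp
  also have "\<dots> = ((2 * b * L * c + 1) * K) * (real M + 1)" by simp
  also have "\<dots> \<le> real M * (real M + 1)"
    by (rule mult_right_mono) (simp_all add: M_def real_nat_ceiling_ge)
  finally show False by (simp add: power2_eq_square algebra_simps)
qed

end
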